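(* Suppose that $A$ and $B$ are paramonotone, let $(z_0,k_0)\in Z\times K$, $x\in X$, and $\rho\in\mathbb{R}$. Then the following hold: (i) $Z-\rho\,\overline{L^*K}$ is convex and closed. (ii) $P_{Z-\rho\overline{L^*K}}(x)=P_Z(x+\rho L^*k_0)+P_{-\rho\overline{L^*K}}(x-z_0)$. (iii) If $(Z-z_0)\perp\rho L^*K$, then $P_{Z-\rho\overline{L^*K}}(x)=P_Z(x)+P_{-\rho\overline{L^*K}}(x-z_0)$. (iv) If $Z\perp\rho(L^*K-L^*k_0)$, then $P_{Z-\rho\overline{L^*K}}(x)=P_Z(x+\rho L^*k_0)+P_{-\rho\overline{L^*K}}(x)$.
   Context: $X$ and $Y$ are real Hilbert spaces, $L\colon X\to Y$ is continuous and linear with adjoint $L^*$, and $A\colon X\rightrightarrows X$ and $B\colon Y\rightrightarrows Y$ are maximally monotone set-valued operators. Inverses are in the sense of set-valued operators. Set $$Z:=\{x\in X: 0\in Ax+L^*BLx\},\qquad K:=\{y\in Y: 0\in B^{-1}y-LA^{-1}(-L^*y)\}.$$ A monotone operator $A$ is paramonotone if $(x_0,u_0),(x_1,u_1)\in\operatorname{gra}A$ and $\langle x_0-x_1,u_0-u_1\rangle=0$ imply $(x_0,u_1)\in\operatorname{gra}A$ and $(x_1,u_0)\in\operatorname{gra}A$. $P_C$ is the projection onto a nonempty closed convex set $C$; $\overline{D}$ is the (norm) closure of $D$; sums, differences and scalar multiples of sets are in the Minkowski sense; $C\perp D$ means $\langle c,d\rangle=0$ for all $c\in C$, $d\in D$.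 *)

theory Defs
  imports "HOL-Analysis.Analysis"
begin

text \<open>
  A set-valued operator is a function into sets. Real Hilbert spaces are types of sort
  \<open>{real_inner, complete_space}\<close>; no finite-dimensionality is assumed. For a bounded linear map
  \<open>L\<close> between Hilbert spaces, the library's \<open>adjoint L\<close> is the Hilbert space adjoint: it is
  specified by \<open>L x \<bullet> y = x \<bullet> adjoint L y\<close>, and a function with this property exists by the Riesz
  representation theorem and is unique.
\<close>

definition gra :: "('a \<Rightarrow> 'b set) \<Rightarrow> ('a \<times> 'b) set" where
  "gra A = {(x, u). u \<in> A x}"

definition inv_op :: "('a \<Rightarrow> 'b set) \<Rightarrow> 'b \<Rightarrow> 'a set" where
  "inv_op A u = {x. (x, u) \<in> gra A}"

definition monotone_op :: "('a::real_inner \<Rightarrow> 'a set) \<Rightarrow> bool" where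
  "monotone_op A \<longleftrightarrow>
     (\<forall>x u y v. (x, u) \<in> gra A \<longrightarrow> (y, v) \<in> gra A \<longrightarrow> (x - y) \<bullet> (u - v) \<ge> 0)"

definition maximally_monotone :: "('a::real_inner \<Rightarrow> 'a set) \<Rightarrow> bool" where
  "maximally_monotone A \<longleftrightarrow>
     monotone_op A \<and> (\<forall>T. monotone_op T \<and> gra A \<subseteq> gra T \<longrightarrow> gra T = gra A)"

definition paramonotone :: "('a::real_inner \<Rightarrow> 'a set) \<Rightarrow> bool" where
  "paramonotone A \<longleftrightarrow> monotone_op A \<and>
     (\<forall>x0 u0 x1 u1. (x0, u0) \<in> gra A \<longrightarrow> (x1, u1) \<in> gra A \<longrightarrow> (x0 - x1) \<bullet> (u0 - u1) = 0
        \<longrightarrow> (x0, u1) \<in> gra A \<and> (x1, u0) \<in> gra A)"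

text \<open>
  On sets, the library's \<open>+\<close> is the Minkowski sum, whereas its binary \<open>-\<close> is set difference and
  its unary \<open>-\<close> is the complement; hence the separate notation for the set of all differences.
  The scalar multiple of a set \<open>C\<close> by \<open>r\<close> is written \<open>(*\<^sub>R) r ` C\<close>.
\<close>

definition minkowski_diff :: "'a::minus set \<Rightarrow> 'a set \<Rightarrow> 'a set"  (infixl \<open>-\<^sub>M\<close> 65) where
  "C -\<^sub>M D = {c - d | c d. c \<in> C \<and> d \<in> D}"

definition orthogonal_sets :: "'a::real_inner set \<Rightarrow> 'a set \<Rightarrow> bool" where
  "orthogonal_sets C D \<longleftrightarrow> (\<forall>c\<in>C. \<forall>d\<in>D. orthogonal c d)"

text \<open>
  The same term as the library's \<open>closest_point\<close>, which is restricted to Heine-Borel (so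
  finite-dimensional) spaces. In a Hilbert space the nearest point exists and is unique whenever
  \<open>C\<close> is nonempty, closed and convex.
\<close>

definition proj :: "'a::real_inner set \<Rightarrow> 'a \<Rightarrow> 'a" where
  "proj C x = (SOME p. p \<in> C \<and> (\<forall>c\<in>C. dist x p \<le> dist x c))"

definition primal_solutions ::
  "('a::real_inner \<Rightarrow> 'a set) \<Rightarrow> ('a \<Rightarrow> 'b::real_inner) \<Rightarrow> ('b \<Rightarrow> 'b set) \<Rightarrow> 'a set" where
  "primal_solutions A L B = {x. 0 \<in> A x + adjoint L ` B (L x)}"

definition dual_solutions ::
  "('a::real_inner \<Rightarrow> 'a set) \<Rightarrow> ('a \<Rightarrow> 'b::real_inner) \<Rightarrow> ('b \<Rightarrow> 'b set) \<Rightarrow> 'b set" where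
  "dual_solutions A L B = {y. 0 \<in> inv_op B y -\<^sub>M L ` inv_op A (- adjoint L y)}"

end

theory Submission
  imports Defs
begin

text \<open>
  Write \<open>D\<close> for the set \<open>- \<rho> cl (L* K)\<close>, so that the set to be projected onto is the Minkowski
  sum \<open>Z + D\<close>. Everything follows from two facts: \<open>Z\<close> and \<open>D\<close> are closed and convex, and their
  directions are orthogonal, \<open>(Z - Z) \<bottom> (D - D)\<close>.

  Both facts come from paramonotonicity. A primal solution \<open>z\<close> comes with a dual witness \<open>y\<close> such
  that \<open>- L* y \<in> A z\<close> and \<open>y \<in> B (L z)\<close>, and a dual solution \<open>k\<close> with a primal witness \<open>w\<close> in
  the same position. The monotonicity inequality of \<open>A\<close> bounds \<open>\<langle>z - w, L* y - L* k\<rangle>\<close> from above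
  by zero and that of \<open>B\<close> bounds the same number from below by zero, so both are equalities, and
  paramonotonicity allows the witnesses to be exchanged (\<open>paramonotone_exchange\<close>). Hence every
  primal solution can be paired with every dual one (\<open>saddle_rectangle\<close>), and the vanishing of
  the inner product is the orthogonality (\<open>primal_dual_orthogonal\<close>). Moreover, fixing a single
  dual solution exhibits \<open>Z\<close> as an intersection of solution sets of monotone inequalities, which
  are closed and convex by maximality; likewise a single primal solution exhibits \<open>K\<close> as convex.

  The rest is Hilbert space geometry. For closed convex sets with orthogonal directions, adding the
  variational inequalities that characterise the two projections gives that of the sum, because
  the cross terms vanish (\<open>proj_orthogonal_sum\<close>). The projections of the summands are taken at the
  point shifted by a fixed element of the other summand; a shift orthogonal to the directions of a
  set does not alter the projection onto it (\<open>proj_add_orthogonal\<close>), which removes one shift or the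
  other under the extra hypotheses.

  Existence of nearest points is proved from completeness. It also gives the Riesz representation
  theorem and thereby the defining identity of the adjoint.
\<close>

section \<open>Nearest points in Hilbert spaces\<close>

text \<open>
  The points of \<open>C\<close> whose squared distance from \<open>x\<close> exceeds the infimum by at most \<open>1/(n+1)\<close> form
  decreasing closed sets. By the parallelogram law, and since midpoints stay in \<open>C\<close>, their
  diameters tend to zero, so by completeness they have a common point.
\<close>

lemma nearest_point_exists:
  fixes C :: "'a::{real_inner, complete_space} set"
  assumes "convex C" "closed C" "C \<noteq> {}"
  shows "\<exists>p\<in>C. \<forall>c\<in>C. dist x p \<le> dist x c"
proof -
  define m where "m = (INF c\<in>C. (norm (x - c))\<^sup>2)"
  define S where "S n = {c \<in> C. (norm (x - c))\<^sup>2 \<le> m + 1 / real (Suc n)}" for n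
  have bdd: "bdd_below ((\<lambda>c. (norm (x - c))\<^sup>2) ` C)"
    by (rule bdd_belowI2[of _ 0]) simp
  have m_le: "m \<le> (norm (x - c))\<^sup>2" if "c \<in> C" for c
    unfolding m_def by (rule cINF_lower[OF bdd that])
  obtain p where p: "\<And>n. p \<in> S n"
  proof (rule decreasing_closed_nest[of S])
    fix n
    have "S n = C \<inter> {c. (norm (x - c))\<^sup>2 \<le> m + 1 / real (Suc n)}"
      by (auto simp: S_def)
    moreover have "closed {c. (norm (x - c))\<^sup>2 \<le> m + 1 / real (Suc n)}"
      by (intro closed_Collect_le continuous_intros)
    ultimately show "closed (S n)"
      using assms(2) by auto
    have "\<exists>c\<in>C. (norm (x - c))\<^sup>2 < m + 1 / real (Suc n)"
      using cINF_less_iff[OF assms(3) bdd, of "m + 1 / real (Suc n)"] by (simp add: m_def)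
    then show "S n \<noteq> {}"
      unfolding S_def by (auto intro: less_imp_le)
  next
    fix k n :: nat
    assume "k \<le> n"
    then have "1 / real (Suc n) \<le> 1 / real (Suc k)"
      by (simp add: frac_le)
    then show "S n \<subseteq> S k"
      unfolding S_def by (auto intro: order_trans)
  next
    fix e :: real
    assume "0 < e"
    then obtain n where n: "4 / e\<^sup>2 < real (Suc n)"
      by (meson less_trans lessI of_nat_less_iff reals_Archimedean2)
    have "dist u v < e" if "u \<in> S n" "v \<in> S n" for u v
    proof -
      have "(1/2) *\<^sub>R u + (1/2) *\<^sub>R v \<in> C"
        using that convexD[OF assms(1), of u v "1/2" "1/2"] by (simp add: S_def)
      then have "m \<le> (norm (x - ((1/2) *\<^sub>R u + (1/2) *\<^sub>R v)))\<^sup>2"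
        by (rule m_le)
      moreover have "(norm (u - v))\<^sup>2 = 2 * (norm (x - u))\<^sup>2 + 2 * (norm (x - v))\<^sup>2
          - 4 * (norm (x - ((1/2) *\<^sub>R u + (1/2) *\<^sub>R v)))\<^sup>2"
        by (simp add: power2_norm_eq_inner inner_commute algebra_simps)
      ultimately have "(norm (u - v))\<^sup>2 \<le> 4 * (1 / real (Suc n))"
        using that by (simp add: S_def)
      also have "\<dots> < e\<^sup>2"
        using n \<open>0 < e\<close> by (simp add: field_simps)
      finally show ?thesis
        using \<open>0 < e\<close> by (simp add: dist_norm power2_less_imp_less)
    qed
    then show "\<exists>n. \<forall>u\<in>S n. \<forall>v\<in>S n. dist u v < e"
      by blast
  qed blast
  have "(norm (x - p))\<^sup>2 \<le> m"
  proof (rule field_le_epsilon)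
    fix e :: real
    assume "0 < e"
    then obtain n where "1 / real (Suc n) < e"
      using nat_approx_posE by blast
    then show "(norm (x - p))\<^sup>2 \<le> m + e"
      using p[of n] by (simp add: S_def)
  qed
  then have "dist x p \<le> dist x c" if "c \<in> C" for c
    using m_le[OF that] by (simp add: dist_norm power2_le_imp_le)
  then show ?thesis
    using p[of 0] by (auto simp: S_def)
qed

text \<open>
  Expanding \<open>\<parallel>x - c\<parallel>\<^sup>2\<close> about \<open>p\<close>, the variational inequality makes the distance to \<open>c\<close> exceed the
  distance to \<open>p\<close> quantitatively in terms of \<open>\<parallel>c - p\<parallel>\<close>; this gives minimality and uniqueness at once.
\<close>

lemma proj_unique:
  assumes "p \<in> C" and "\<And>c. c \<in> C \<Longrightarrow> (x - p) \<bullet> (c - p) \<le> 0"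
  shows "proj C x = p"
proof -
  have *: "(norm (x - p))\<^sup>2 + (norm (c - p))\<^sup>2 \<le> (norm (x - c))\<^sup>2" if "c \<in> C" for c
  proof -
    have "(norm (x - c))\<^sup>2 = (norm (x - p))\<^sup>2 + (norm (c - p))\<^sup>2 - 2 * ((x - p) \<bullet> (c - p))"
      by (simp add: power2_norm_eq_inner inner_commute algebra_simps)
    then show ?thesis
      using assms(2)[OF that] by linarith
  qed
  have near: "dist x p \<le> dist x c" if "c \<in> C" for c
  proof -
    have "(norm (x - p))\<^sup>2 \<le> (norm (x - c))\<^sup>2"
      using *[OF that] zero_le_power2[of "norm (c - p)"] by linarith
    then show ?thesis
      unfolding dist_norm by (rule power2_le_imp_le) simp
  qed
  show ?thesis
    unfolding proj_def
  proof (rule some_equality)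
    show "p \<in> C \<and> (\<forall>c\<in>C. dist x p \<le> dist x c)"
      using assms(1) near by blast
    fix q
    assume q: "q \<in> C \<and> (\<forall>c\<in>C. dist x q \<le> dist x c)"
    then have "(norm (x - q))\<^sup>2 \<le> (norm (x - p))\<^sup>2"
      using assms(1) by (simp add: dist_norm)
    with *[of q] q have "(norm (q - p))\<^sup>2 \<le> 0"
      by linarith
    then show "q = p"
      by simp
  qed
qed

lemma
  fixes C :: "'a::{real_inner, complete_space} set"
  assumes "convex C" "closed C" "C \<noteq> {}"
  shows proj_in: "proj C x \<in> C"
    and proj_variational: "c \<in> C \<Longrightarrow> (x - proj C x) \<bullet> (c - proj C x) \<le> 0"
proof -
  have "\<exists>p. p \<in> C \<and> (\<forall>c\<in>C. dist x p \<le> dist x c)"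
    using nearest_point_exists[OF assms, of x] by (simp add: Bex_def)
  then have near: "proj C x \<in> C \<and> (\<forall>c\<in>C. dist x (proj C x) \<le> dist x c)"
    unfolding proj_def by (rule someI_ex)
  then show "proj C x \<in> C"
    by (rule conjunct1)
  then show "(x - proj C x) \<bullet> (c - proj C x) \<le> 0" if "c \<in> C"
    using any_closest_point_dot[OF assms(1,2) _ that] near by simp
qed

text \<open>
  A displacement orthogonal to the directions of \<open>C\<close> leaves the variational inequality at the
  nearest point unchanged.
\<close>

lemma proj_add_orthogonal:
  fixes C :: "'a::{real_inner, complete_space} set"
  assumes "convex C" "closed C" "a \<in> C" and "\<And>c. c \<in> C \<Longrightarrow> v \<bullet> (c - a) = 0"
  shows "proj C (x + v) = proj C x"
proof (rule proj_unique)
  have "C \<noteq> {}"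
    using assms(3) by blast
  note C = assms(1,2) this
  show "proj C x \<in> C"
    by (rule proj_in[OF C])
  fix c
  assume "c \<in> C"
  then have "v \<bullet> (c - proj C x) = 0"
    using assms(4)[of c] assms(4)[OF proj_in[OF C], of x] by (simp add: inner_diff_right)
  with proj_variational[OF C \<open>c \<in> C\<close>, of x]
  show "(x + v - proj C x) \<bullet> (c - proj C x) \<le> 0"
    by (simp add: inner_diff_left inner_add_left)
qed

section \<open>The Hilbert space adjoint\<close>

text \<open>
  The nearest point \<open>p\<close> to the origin in the hyperplane \<open>f = 1\<close> is orthogonal to the kernel of \<open>f\<close>.
  Since \<open>x - f x p\<close> lies in that kernel, \<open>f\<close> is the inner product with a multiple of \<open>p\<close>.
\<close>

lemma riesz_representation:
  fixes f :: "'a::{real_inner, complete_space} \<Rightarrow> real"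
  assumes "bounded_linear f"
  shows "\<exists>r. \<forall>x. f x = x \<bullet> r"
proof (cases "\<exists>u. f u \<noteq> 0")
  case False
  then show ?thesis
    by (intro exI[of _ 0]) simp
next
  case True
  interpret f: bounded_linear f by fact
  obtain u where "f u \<noteq> 0"
    using True by blast
  let ?H = "f -` {1}"
  have "f (u /\<^sub>R f u) = 1"
    using \<open>f u \<noteq> 0\<close> by (simp add: f.scaleR)
  then have "?H \<noteq> {}"
    by blast
  moreover have "convex ?H"
    by (intro convex_linear_vimage f.linear) simp
  moreover have "closed ?H"
    by (intro closed_vimage continuous_on_id f.continuous_on) simp
  ultimately have H: "convex ?H" "closed ?H" "?H \<noteq> {}"
    by blast+
  define p where "p = proj ?H 0"
  have fp: "f p = 1"
    using proj_in[OF H, of 0] by (simp add: p_def)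
  then have "p \<noteq> 0"
    using f.zero by force
  have ker: "v \<bullet> p = 0" if "f v = 0" for v
  proof -
    have "p + v \<in> ?H" "p - v \<in> ?H"
      using fp that by (simp_all add: f.add f.diff)
    from this[THEN proj_variational[OF H, of _ 0]] show ?thesis
      by (simp add: p_def[symmetric] inner_commute)
  qed
  have "f x = x \<bullet> (p /\<^sub>R (p \<bullet> p))" for x
  proof -
    have "(x - f x *\<^sub>R p) \<bullet> p = 0"
      by (rule ker) (simp add: f.diff f.scaleR fp)
    then show ?thesis
      using \<open>p \<noteq> 0\<close> by (simp add: inner_diff_left field_simps)
  qed
  then show ?thesis
    by blast
qed

lemma inner_adjoint:
  fixes L :: "'a::{real_inner, complete_space} \<Rightarrow> 'b::real_inner"
  assumes "bounded_linear L"
  shows "x \<bullet> adjoint L y = L x \<bullet> y"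
proof -
  have "\<forall>y. \<exists>r. \<forall>x. L x \<bullet> y = x \<bullet> r"
    by (rule allI, rule riesz_representation,
        rule bounded_linear_compose[OF bounded_linear_inner_left assms])
  from choice[OF this] have "\<exists>f'. \<forall>x y. L x \<bullet> y = x \<bullet> f' y"
    by blast
  then have "\<forall>x y. L x \<bullet> y = x \<bullet> adjoint L y"
    unfolding adjoint_def by (rule someI_ex)
  then show ?thesis
    by simp
qed

lemma linear_adjoint:
  fixes L :: "'a::{real_inner, complete_space} \<Rightarrow> 'b::real_inner"
  assumes "bounded_linear L"
  shows "linear (adjoint L)"
proof (rule linearI)
  show "adjoint L (y + y') = adjoint L y + adjoint L y'" for y y'
    by (rule vector_eq_ldot[THEN iffD1]) (simp add: inner_adjoint[OF assms] inner_add_right)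
  show "adjoint L (c *\<^sub>R y) = c *\<^sub>R adjoint L y" for c y
    by (rule vector_eq_ldot[THEN iffD1]) (simp add: inner_adjoint[OF assms])
qed

section \<open>Sums of sets with orthogonal directions\<close>

text \<open>
  With \<open>p\<close> and \<open>q\<close> the projections of the shifted points, the variational inequality for \<open>p + q\<close>
  splits into those for \<open>p\<close> and \<open>q\<close> and cross terms that vanish by orthogonality. Closedness
  then comes for free: for \<open>w\<close> in the closure of the sum, the inequality for the projection \<open>p + q\<close>
  of \<open>w\<close> passes to the limit, and testing it against \<open>w\<close> itself gives \<open>w = p + q\<close>.
\<close>

lemma
  fixes C D :: "'a::{real_inner, complete_space} set"
  assumes C: "convex C" "closed C" and D: "convex D" "closed D"
    and "c0 \<in> C" "d0 \<in> D"
    and orth: "\<And>c d. c \<in> C \<Longrightarrow> d \<in> D \<Longrightarrow> (c - c0) \<bullet> (d - d0) = 0"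
  shows proj_orthogonal_sum: "proj (C + D) x = proj C (x - d0) + proj D (x - c0)"
    and closed_orthogonal_sum: "closed (C + D)"
proof -
  have ne: "C \<noteq> {}" "D \<noteq> {}"
    using assms by blast+
  have orth': "(c - c') \<bullet> (d - d') = 0" if "c \<in> C" "c' \<in> C" "d \<in> D" "d' \<in> D" for c c' d d'
    using orth[of c d] orth[of c d'] orth[of c' d] orth[of c' d'] that
    by (simp add: inner_diff_left inner_diff_right)
  let ?p = "\<lambda>x. proj C (x - d0)" and ?q = "\<lambda>x. proj D (x - c0)"
  have p: "?p x \<in> C" and q: "?q x \<in> D" for x
    by (rule proj_in[OF C ne(1)], rule proj_in[OF D ne(2)])
  then have mem: "?p x + ?q x \<in> C + D" for x
    by (rule set_plus_intro)
  have var: "(x - (?p x + ?q x)) \<bullet> (w - (?p x + ?q x)) \<le> 0" if w: "w \<in> C + D" for x w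
  proof -
    from w obtain c d where cd: "w = c + d" "c \<in> C" "d \<in> D"
      by (rule set_plus_elim)
    have "(x - (?p x + ?q x)) \<bullet> (w - (?p x + ?q x))
        = (x - d0 - ?p x) \<bullet> (c - ?p x) - (c - ?p x) \<bullet> (?q x - d0)
          + (x - c0 - ?q x) \<bullet> (d - ?q x) - (?p x - c0) \<bullet> (d - ?q x)"
      unfolding cd(1) by (simp add: inner_commute algebra_simps)
    also have "\<dots> = (x - d0 - ?p x) \<bullet> (c - ?p x) + (x - c0 - ?q x) \<bullet> (d - ?q x)"
      using orth' cd p q assms by simp
    also have "\<dots> \<le> 0"
      using proj_variational[OF C ne(1) cd(2)] proj_variational[OF D ne(2) cd(3)]
      by (simp add: add_nonpos_nonpos)
    finally show ?thesis .
  qed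
  show "proj (C + D) x = ?p x + ?q x"
    by (rule proj_unique[OF mem var])
  have "w \<in> C + D" if "w \<in> closure (C + D)" for w
  proof -
    have "closed {v. (w - (?p w + ?q w)) \<bullet> (v - (?p w + ?q w)) \<le> 0}"
      by (intro closed_Collect_le continuous_intros)
    then have "closure (C + D) \<subseteq> {v. (w - (?p w + ?q w)) \<bullet> (v - (?p w + ?q w)) \<le> 0}"
      using var by (intro closure_minimal) auto
    with that have "(w - (?p w + ?q w)) \<bullet> (w - (?p w + ?q w)) \<le> 0"
      by blast
    then have "w - (?p w + ?q w) = 0"
      by (metis inner_ge_zero inner_eq_zero_iff antisym)
    then have "w = ?p w + ?q w"
      by (rule eq_iff_diff_eq_0[THEN iffD2])
    then show ?thesis
      using mem[of w] by simp
  qed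
  then show "closed (C + D)"
    by (metis closure_subset closure_subset_eq subsetI)
qed

section \<open>Maximally monotone operators\<close>

text \<open>
  A point that is monotonically related to the whole graph can be added to it, so by maximality it
  is already there. For fixed \<open>x\<close> or fixed \<open>u\<close> this describes the values of the operator and of
  its inverse as intersections of half-spaces.
\<close>

lemma maximally_monotone_iff:
  assumes "maximally_monotone A"
  shows "u \<in> A x \<longleftrightarrow> (\<forall>(y, v)\<in>gra A. 0 \<le> (x - y) \<bullet> (u - v))"
proof
  assume "u \<in> A x"
  then show "\<forall>(y, v)\<in>gra A. 0 \<le> (x - y) \<bullet> (u - v)"
    using assms by (auto simp: maximally_monotone_def monotone_op_def gra_def)
next
  assume R: "\<forall>(y, v)\<in>gra A. 0 \<le> (x - y) \<bullet> (u - v)"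
  let ?T = "A(x := insert u (A x))"
  have gra_T: "gra ?T = insert (x, u) (gra A)"
    by (auto simp: gra_def split: if_splits)
  have R': "\<forall>(y, v)\<in>gra A. 0 \<le> (y - x) \<bullet> (v - u)"
    using R by (auto simp: algebra_simps)
  have "monotone_op ?T"
    using assms R R' unfolding maximally_monotone_def monotone_op_def gra_T by auto
  then have "gra ?T = gra A"
    using assms gra_T unfolding maximally_monotone_def by blast
  then show "u \<in> A x"
    unfolding gra_T by (auto simp: gra_def)
qed

lemma convex_maximally_monotone_value:
  assumes "maximally_monotone A"
  shows "convex (A x)"
proof -
  have "A x = (\<Inter>(y, v)\<in>gra A. {u. (x - y) \<bullet> u \<ge> (x - y) \<bullet> v})"
    using maximally_monotone_iff[OF assms, of _ x] by (auto simp: inner_diff_right)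
  then show ?thesis
    by (auto intro!: convex_INT convex_halfspace_ge)
qed

lemma
  assumes "maximally_monotone A"
  shows convex_maximally_monotone_inverse: "convex {x. u \<in> A x}"
    and closed_maximally_monotone_inverse: "closed {x. u \<in> A x}"
proof -
  have "(x - y) \<bullet> (u - v) = (u - v) \<bullet> x - (u - v) \<bullet> y" for x y v
    by (metis inner_commute inner_diff_right)
  then have "{x. u \<in> A x} = (\<Inter>(y, v)\<in>gra A. {x. (u - v) \<bullet> x \<ge> (u - v) \<bullet> y})"
    using maximally_monotone_iff[OF assms, of u]
    by auto
  then show "convex {x. u \<in> A x}" "closed {x. u \<in> A x}"
    by (auto intro!: convex_INT convex_halfspace_ge closed_INT closed_halfspace_ge)
qed

section \<open>Primal and dual solutions\<close>

lemma mem_primal_solutions: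
  fixes A :: "'a::real_inner \<Rightarrow> 'a set"
  shows "z \<in> primal_solutions A L B \<longleftrightarrow> (\<exists>y. - adjoint L y \<in> A z \<and> y \<in> B (L z))"
proof -
  have "0 = a + b \<longleftrightarrow> a = - b" for a b :: 'a
    by (metis eq_neg_iff_add_eq_0)
  then show ?thesis
    by (auto simp: primal_solutions_def set_plus_def)
qed

lemma mem_dual_solutions:
  "k \<in> dual_solutions A L B \<longleftrightarrow> (\<exists>z. - adjoint L k \<in> A z \<and> k \<in> B (L z))"
proof -
  have "k \<in> dual_solutions A L B \<longleftrightarrow> (\<exists>w z. 0 = w - L z \<and> - adjoint L k \<in> A z \<and> k \<in> B w)"
    unfolding dual_solutions_def minkowski_diff_def inv_op_def gra_def by blast
  then show ?thesis
    by simp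
qed

lemma paramonotone_swap:
  assumes "paramonotone A" "u \<in> A x" "v \<in> A y" "(x - y) \<bullet> (u - v) = 0"
  shows "v \<in> A x"
  using assms unfolding paramonotone_def gra_def by blast

text \<open>
  The two monotonicity inequalities bound the same number, once from above and once from below:
  the adjoint moves the inequality for \<open>B\<close> into the domain of \<open>L\<close>, where it is the negative of the
  one for \<open>A\<close>. So both are equalities, which is the situation that paramonotonicity speaks about.
\<close>

lemma paramonotone_exchange:
  fixes L :: "'a::{real_inner, complete_space} \<Rightarrow> 'b::real_inner"
  assumes L: "bounded_linear L" and A: "paramonotone A" and B: "paramonotone B"
    and z: "- adjoint L y \<in> A z" "y \<in> B (L z)"
    and k: "- adjoint L k \<in> A w" "k \<in> B (L w)"
  shows "- adjoint L k \<in> A z \<and> k \<in> B (L z)" and "(z - w) \<bullet> (adjoint L y - adjoint L k) = 0"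
proof -
  have "0 \<le> (z - w) \<bullet> (- adjoint L y - - adjoint L k)"
    using A z(1) k(1) unfolding paramonotone_def monotone_op_def gra_def by blast
  moreover have "0 \<le> (L z - L w) \<bullet> (y - k)"
    using B z(2) k(2) unfolding paramonotone_def monotone_op_def gra_def by blast
  moreover have "(L z - L w) \<bullet> (y - k) = (z - w) \<bullet> (adjoint L y - adjoint L k)"
    by (simp add: inner_diff_right inner_adjoint[OF L] linear_diff[OF bounded_linear.linear[OF L]])
  moreover have "(z - w) \<bullet> (- adjoint L y - - adjoint L k)
      = - ((z - w) \<bullet> (adjoint L y - adjoint L k))"
    by (simp add: inner_diff_right)
  ultimately have zero: "(z - w) \<bullet> (- adjoint L y - - adjoint L k) = 0"
    "(L z - L w) \<bullet> (y - k) = 0"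
    by linarith+
  then show "(z - w) \<bullet> (adjoint L y - adjoint L k) = 0"
    by (simp add: inner_diff_right)
  have "- adjoint L k \<in> A z"
    by (rule paramonotone_swap[OF A z(1) k(1) zero(1)])
  moreover have "k \<in> B (L z)"
    by (rule paramonotone_swap[OF B z(2) k(2) zero(2)])
  ultimately show "- adjoint L k \<in> A z \<and> k \<in> B (L z)"
    by blast
qed

text \<open>
  The exchange applies to the witnesses that the two solutions come with, so the pairs of solutions
  that witness each other form the full rectangle of primal and dual solutions.
\<close>

lemma saddle_rectangle:
  fixes L :: "'a::{real_inner, complete_space} \<Rightarrow> 'b::real_inner"
  assumes "bounded_linear L" "paramonotone A" "paramonotone B"
    and "z \<in> primal_solutions A L B" "k \<in> dual_solutions A L B"
  shows "- adjoint L k \<in> A z" and "k \<in> B (L z)"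
proof -
  have "- adjoint L k \<in> A z \<and> k \<in> B (L z)"
    using assms(4,5) paramonotone_exchange(1)[OF assms(1-3)]
    unfolding mem_primal_solutions mem_dual_solutions by blast
  then show "- adjoint L k \<in> A z" and "k \<in> B (L z)"
    by blast+
qed

lemma primal_dual_orthogonal:
  fixes L :: "'a::{real_inner, complete_space} \<Rightarrow> 'b::real_inner"
  assumes "bounded_linear L" "paramonotone A" "paramonotone B"
    and "z \<in> primal_solutions A L B" "z' \<in> primal_solutions A L B"
    and "k \<in> dual_solutions A L B" "k' \<in> dual_solutions A L B"
  shows "(z - z') \<bullet> (adjoint L k - adjoint L k') = 0"
  using paramonotone_exchange(2)[OF assms(1-3)] saddle_rectangle[OF assms(1-3)] assms(4-)
  by blast

text \<open>
  As any dual solution is a witness for every primal one, the existential quantifier over witnesses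
  can be replaced by one fixed choice; this is what makes the solution set convex and closed.
\<close>

lemma primal_solutions_eq:
  fixes L :: "'a::{real_inner, complete_space} \<Rightarrow> 'b::real_inner"
  assumes "bounded_linear L" "paramonotone A" "paramonotone B" "k \<in> dual_solutions A L B"
  shows "primal_solutions A L B = {z. - adjoint L k \<in> A z} \<inter> L -` {w. k \<in> B w}"
  using saddle_rectangle[OF assms(1-3) _ assms(4)] by (auto simp: mem_primal_solutions)

lemma dual_solutions_eq:
  fixes L :: "'a::{real_inner, complete_space} \<Rightarrow> 'b::real_inner"
  assumes "bounded_linear L" "paramonotone A" "paramonotone B" "z \<in> primal_solutions A L B"
  shows "dual_solutions A L B = (\<lambda>y. - adjoint L y) -` A z \<inter> B (L z)"
  using saddle_rectangle[OF assms(1-4)] by (auto simp: mem_dual_solutions)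

lemma
  fixes L :: "'a::{real_inner, complete_space} \<Rightarrow> 'b::real_inner"
  assumes L: "bounded_linear L" and A: "maximally_monotone A" and B: "maximally_monotone B"
    and "paramonotone A" "paramonotone B" "k \<in> dual_solutions A L B"
  shows convex_primal_solutions: "convex (primal_solutions A L B)"
    and closed_primal_solutions: "closed (primal_solutions A L B)"
proof -
  note eq = primal_solutions_eq[OF L assms(4-6)]
  show "convex (primal_solutions A L B)"
    unfolding eq
    by (intro convex_Int convex_linear_vimage bounded_linear.linear[OF L]
        convex_maximally_monotone_inverse[OF A] convex_maximally_monotone_inverse[OF B])
  show "closed (primal_solutions A L B)"
    unfolding eq
    by (intro closed_Int closed_vimage closed_maximally_monotone_inverse[OF A]
        closed_maximally_monotone_inverse[OF B] bounded_linear.continuous_on[OF L] continuous_on_id)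
qed

lemma convex_dual_solutions:
  fixes L :: "'a::{real_inner, complete_space} \<Rightarrow> 'b::real_inner"
  assumes L: "bounded_linear L" and A: "maximally_monotone A" and B: "maximally_monotone B"
    and "paramonotone A" "paramonotone B" "z \<in> primal_solutions A L B"
  shows "convex (dual_solutions A L B)"
  unfolding dual_solutions_eq[OF L assms(4-6)]
  by (intro convex_Int convex_linear_vimage linear_compose_neg linear_adjoint[OF L]
      convex_maximally_monotone_value[OF A] convex_maximally_monotone_value[OF B])

section \<open>Projecting onto the difference of primal and dual solutions\<close>

lemma minkowski_diff_scaled: "C -\<^sub>M (*\<^sub>R) r ` D = C + (*\<^sub>R) (- r) ` D"
  for C D :: "'a::real_vector set"
  by (force simp: minkowski_diff_def set_plus_def)

lemma inner_eq_on_scaled_closure: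
  fixes a :: "'a::real_inner"
  assumes "\<And>s. s \<in> S \<Longrightarrow> a \<bullet> (r *\<^sub>R s) = t" and "d \<in> (*\<^sub>R) r ` closure S"
  shows "a \<bullet> d = t"
proof -
  have "closed {s. a \<bullet> (r *\<^sub>R s) = t}"
    by (intro closed_Collect_eq continuous_intros)
  then have "closure S \<subseteq> {s. a \<bullet> (r *\<^sub>R s) = t}"
    using assms(1) by (intro closure_minimal) auto
  then show ?thesis
    using assms(2) by blast
qed

theorem theorem8p1:
  fixes A :: "'a::{real_inner, complete_space} \<Rightarrow> 'a set"
    and B :: "'b::{real_inner, complete_space} \<Rightarrow> 'b set"
    and L :: "'a \<Rightarrow> 'b"
    and Z :: "'a set" and K :: "'b set"
    and z0 x :: 'a and k0 :: 'b and \<rho> :: real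
  assumes "bounded_linear L"
    and "maximally_monotone A" and "maximally_monotone B"
    and Z_def: "Z = primal_solutions A L B"
    and K_def: "K = dual_solutions A L B"
    and "paramonotone A" and "paramonotone B"
    and "z0 \<in> Z" and "k0 \<in> K"
  shows "(convex (Z -\<^sub>M (*\<^sub>R) \<rho> ` closure (adjoint L ` K))
           \<and> closed (Z -\<^sub>M (*\<^sub>R) \<rho> ` closure (adjoint L ` K)))
    \<and> proj (Z -\<^sub>M (*\<^sub>R) \<rho> ` closure (adjoint L ` K)) x
          = proj Z (x + \<rho> *\<^sub>R adjoint L k0)
            + proj ((*\<^sub>R) (- \<rho>) ` closure (adjoint L ` K)) (x - z0)
    \<and> (orthogonal_sets (Z -\<^sub>M {z0}) ((*\<^sub>R) \<rho> ` adjoint L ` K) \<longrightarrow>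
          proj (Z -\<^sub>M (*\<^sub>R) \<rho> ` closure (adjoint L ` K)) x
            = proj Z x + proj ((*\<^sub>R) (- \<rho>) ` closure (adjoint L ` K)) (x - z0))
    \<and> (orthogonal_sets Z ((*\<^sub>R) \<rho> ` (adjoint L ` K -\<^sub>M {adjoint L k0})) \<longrightarrow>
          proj (Z -\<^sub>M (*\<^sub>R) \<rho> ` closure (adjoint L ` K)) x
            = proj Z (x + \<rho> *\<^sub>R adjoint L k0)
              + proj ((*\<^sub>R) (- \<rho>) ` closure (adjoint L ` K)) x)"
proof -
  note L = assms(1) and A = assms(2) and B = assms(3) and pA = assms(6) and pB = assms(7)
  note Z = convex_primal_solutions[OF L A B pA pB assms(9)[unfolded K_def], folded Z_def]
    closed_primal_solutions[OF L A B pA pB assms(9)[unfolded K_def], folded Z_def]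
  let ?D = "(*\<^sub>R) (- \<rho>) ` closure (adjoint L ` K)"
  let ?d0 = "- \<rho> *\<^sub>R adjoint L k0"
  have "convex K"
    unfolding K_def by (rule convex_dual_solutions[OF L A B pA pB assms(8)[unfolded Z_def]])
  then have "convex ?D"
    by (intro convex_scaling convex_closure convex_linear_image linear_adjoint[OF L])
  moreover have "closed ?D"
    by (intro closed_scaling closed_closure)
  ultimately have D: "convex ?D" "closed ?D"
    by blast+
  have "adjoint L k0 \<in> closure (adjoint L ` K)"
    by (rule subsetD[OF closure_subset imageI[OF \<open>k0 \<in> K\<close>]])
  then have d0: "?d0 \<in> ?D"
    by (rule imageI)
  \<comment> \<open>Orthogonality is known only for values of the adjoint on dual solutions; it passes to the
    closure by continuity of the inner product.\<close>
  have orth: "(z - z0) \<bullet> (d - ?d0) = 0" if "z \<in> Z" "d \<in> ?D" for z d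
  proof -
    have "(z - z0) \<bullet> d = (z - z0) \<bullet> ?d0"
    proof (rule inner_eq_on_scaled_closure[OF _ \<open>d \<in> ?D\<close>])
      fix s
      assume "s \<in> adjoint L ` K"
      then have "(z - z0) \<bullet> (s - adjoint L k0) = 0"
        using primal_dual_orthogonal[OF L pA pB] that(1) \<open>z0 \<in> Z\<close> \<open>k0 \<in> K\<close>
        unfolding Z_def K_def by blast
      then show "(z - z0) \<bullet> (- \<rho> *\<^sub>R s) = (z - z0) \<bullet> ?d0"
        by (simp add: inner_diff_right)
    qed
    then show ?thesis
      by (simp only: inner_diff_right diff_self)
  qed
  note sum = Z D \<open>z0 \<in> Z\<close> d0 orth
  have i: "convex (Z + ?D)" "closed (Z + ?D)"
    by (rule convex_set_plus[OF Z(1) D(1)], rule closed_orthogonal_sum[OF sum])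
  have ii: "proj (Z + ?D) x = proj Z (x + \<rho> *\<^sub>R adjoint L k0) + proj ?D (x - z0)"
    using proj_orthogonal_sum[OF sum, of x] by simp
  \<comment> \<open>Each extra orthogonality hypothesis makes one of the two shifts of the point harmless.\<close>
  have iii: "proj Z (x + \<rho> *\<^sub>R adjoint L k0) = proj Z x"
    if "orthogonal_sets (Z -\<^sub>M {z0}) ((*\<^sub>R) \<rho> ` adjoint L ` K)"
  proof (rule proj_add_orthogonal[OF Z \<open>z0 \<in> Z\<close>])
    fix z
    assume "z \<in> Z"
    then have "z - z0 \<in> Z -\<^sub>M {z0}"
      by (auto simp: minkowski_diff_def)
    then show "(\<rho> *\<^sub>R adjoint L k0) \<bullet> (z - z0) = 0"
      using that \<open>k0 \<in> K\<close> by (auto simp: orthogonal_sets_def orthogonal_def inner_commute)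
  qed
  have iv: "proj ?D (x - z0) = proj ?D x"
    if "orthogonal_sets Z ((*\<^sub>R) \<rho> ` (adjoint L ` K -\<^sub>M {adjoint L k0}))"
  proof -
    have "(- z0) \<bullet> (d - ?d0) = 0" if "d \<in> ?D" for d
    proof -
      have "z0 \<bullet> d = z0 \<bullet> ?d0"
      proof (rule inner_eq_on_scaled_closure[OF _ \<open>d \<in> ?D\<close>])
        fix s
        assume "s \<in> adjoint L ` K"
        then have "\<rho> *\<^sub>R (s - adjoint L k0)
            \<in> (*\<^sub>R) \<rho> ` (adjoint L ` K -\<^sub>M {adjoint L k0})"
          by (auto simp: minkowski_diff_def)
        then have "z0 \<bullet> (\<rho> *\<^sub>R (s - adjoint L k0)) = 0"
          using \<open>orthogonal_sets _ _\<close> \<open>z0 \<in> Z\<close>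
          by (auto simp: orthogonal_sets_def orthogonal_def)
        then show "z0 \<bullet> (- \<rho> *\<^sub>R s) = z0 \<bullet> ?d0"
          by (simp add: algebra_simps)
      qed
      then show ?thesis
        by (simp only: inner_minus_left inner_diff_right diff_self minus_zero)
    qed
    from proj_add_orthogonal[OF D d0 this] show ?thesis
      by simp
  qed
  show ?thesis
    unfolding minkowski_diff_scaled using i ii iii iv by simp
qed

end
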